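(* For any $k\geq1$, the Boolean algebra $\mathcal B_k$ is generated by the languages $K_{\mathcal Q,\bar B}$, where $\mathcal Q=(Q_1,\dots,Q_\ell)$ ranges over finite colourings of $\mathbb N^k$ with $\ell\geq1$ colours and $\bar B=(B_1,\dots,B_\ell)$ ranges over $\mathcal P(A^k)^\ell$.
   Context: $A$ is a finite alphabet. For $\bar a\in A^k$, $w\in A^*$: $c_{\bar a}(w):=\{\bar i\in\mathbb N^k: i_j<|w|, w_{i_j}=a_j\ \forall j\}$; for $Q\subseteq\mathbb N^k$, $L_{\Diamond^{\bar a}_Q}:=\{w: c_{\bar a}(w)\cap Q\neq\emptyset\}$; $\mathcal B_k$ is the Boolean subalgebra of $\mathcal P(A^* )$ generated by all $L_{\Diamond^{\bar a}_Q}$. The content of $w$ on $Q$ is $\langle w,Q\rangle:=\{\bar a\in A^k: c_{\bar a}(w)\cap Q\neq\emptyset\}$. A finite colouring of $\mathbb N^k$ with $\ell$ colours is a family $(Q_1,\dots,Q_\ell)$ of pairwise disjoint subsets with union $\mathbb N^k$. $K_{Q,B}:=\{w\in A^*:\langle w,Q\rangle=B\}$ and $K_{\mathcal Q,\bar B}:=\bigcap_{j=1}^\ell K_{Q_j,B_j}$. *)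

theory Defs
  imports "HOL-Analysis.Sigma_Algebra"
begin

text \<open>Both \<open>A\<^sup>k\<close> and \<open>\<nat>\<^sup>k\<close> (with \<open>A = UNIV\<close>) are represented by lists of length \<open>k\<close>;
  components are numbered from \<open>0\<close>.\<close>

definition tuples :: "'a set \<Rightarrow> nat \<Rightarrow> 'a list set" where
  "tuples A k = {xs. set xs \<subseteq> A \<and> length xs = k}"

text \<open>\<open>\<Omega>\<close> is the top element, and complements are taken relative to it.
  A \<open>\<G>\<close> that is not a family of subsets of \<open>\<Omega>\<close> yields the junk value \<open>UNIV\<close>.\<close>

definition generated_algebra :: "'a set \<Rightarrow> 'a set set \<Rightarrow> 'a set set" where
  "generated_algebra \<Omega> \<G> = algebra \<Omega> hull \<G>"

lemma algebra_generated_algebra: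
  assumes "\<G> \<subseteq> Pow \<Omega>"
  shows "algebra \<Omega> (generated_algebra \<Omega> \<G>)"
proof -
  have Int: "algebra \<Omega> (\<Inter>\<F>)"
    if "\<And>M. M \<in> \<F> \<Longrightarrow> algebra \<Omega> M" "Pow \<Omega> \<in> \<F>" for \<F>
    using that by (simp add: algebra_iff_Un Inter_lower)
  show ?thesis
    unfolding generated_algebra_def hull_def
    by (rule Int) (use assms algebra_Pow in auto)
qed

text \<open>The set \<open>c\<^sub>a(w)\<close>; the arity \<open>k\<close> is the length of \<open>a\<close>.\<close>

definition occs :: "'a list \<Rightarrow> 'a list \<Rightarrow> nat list set" where
  "occs a w = {is \<in> tuples UNIV (length a).
     \<forall>j<length a. is ! j < length w \<and> w ! (is ! j) = a ! j}"

definition L_diamond :: "'a set \<Rightarrow> 'a list \<Rightarrow> nat list set \<Rightarrow> 'a list set" where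
  "L_diamond A a Q = {w \<in> lists A. occs a w \<inter> Q \<noteq> {}}"

definition Bool_alg :: "'a set \<Rightarrow> nat \<Rightarrow> 'a list set set" where
  "Bool_alg A k = generated_algebra (lists A)
     {L_diamond A a Q | a Q. a \<in> tuples A k \<and> Q \<subseteq> tuples UNIV k}"

definition content :: "'a set \<Rightarrow> nat \<Rightarrow> 'a list \<Rightarrow> nat list set \<Rightarrow> 'a list set" where
  "content A k w Q = {a \<in> tuples A k. occs a w \<inter> Q \<noteq> {}}"

text \<open>Disjointness is indexwise, so empty colour classes may occur, even repeatedly.\<close>

definition colouring :: "nat \<Rightarrow> nat \<Rightarrow> nat list set list \<Rightarrow> bool" where
  "colouring k l Qs \<longleftrightarrow> length Qs = l \<and>
     (\<forall>i<l. \<forall>j<l. i \<noteq> j \<longrightarrow> Qs ! i \<inter> Qs ! j = {}) \<and>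
     (\<Union>j<l. Qs ! j) = tuples UNIV k"

definition K_lang :: "'a set \<Rightarrow> nat \<Rightarrow> nat list set \<Rightarrow> 'a list set \<Rightarrow> 'a list set" where
  "K_lang A k Q B = {w \<in> lists A. content A k w Q = B}"

definition K_langs :: "'a set \<Rightarrow> nat \<Rightarrow> nat list set list \<Rightarrow> 'a list set list \<Rightarrow> 'a list set" where
  "K_langs A k Qs Bs = (\<Inter>j<length Qs. K_lang A k (Qs ! j) (Bs ! j))"

end

theory Submission
  imports Defs
begin

text \<open>\<open>K\<^sub>Q\<^sub>,\<^sub>B\<close> is the intersection, over the finitely many tuples \<open>a\<close>, of \<open>L\<^sub>\<diamond>\<close> for
  \<open>a \<in> B\<close> and of its complement for \<open>a \<notin> B\<close>. Conversely, \<open>L\<^sub>\<diamond>\<close> for \<open>a\<close> and \<open>Q\<close> is the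
  union of the finitely many \<open>K\<close>-languages of the two-colouring \<open>(Q, \<nat>\<^sup>k - Q)\<close> whose content
  on \<open>Q\<close> contains \<open>a\<close>.\<close>

lemma finite_tuples: "finite A \<Longrightarrow> finite (tuples A k)"
  unfolding tuples_def by (rule finite_lists_length_eq)

lemma generated_algebra_superset: "\<G> \<subseteq> generated_algebra \<Omega> \<G>"
  unfolding generated_algebra_def by (rule hull_subset)

lemma generated_algebra_minimal:
  assumes "\<G> \<subseteq> M" "algebra \<Omega> M"
  shows "generated_algebra \<Omega> \<G> \<subseteq> M"
  unfolding generated_algebra_def using assms by (rule hull_minimal)

lemma content_subset: "content A k w Q \<subseteq> tuples A k"
  by (auto simp: content_def)

text \<open>A complement of a union, rather than an intersection, stays correct when
  \<open>tuples A k\<close> is empty: an empty intersection would be \<open>UNIV\<close>. As B lies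
  in \<open>tuples A k\<close>, equality of the content with B can be tested tuple by tuple.\<close>

lemma K_lang_eq_Diff_UN:
  assumes "B \<subseteq> tuples A k"
  shows "K_lang A k Q B = lists A -
    (\<Union>a\<in>tuples A k. if a \<in> B then lists A - L_diamond A a Q else L_diamond A a Q)"
  using assms by (auto simp: K_lang_def content_def L_diamond_def split: if_splits)

lemma K_lang_in_algebra:
  assumes "algebra (lists A) M" "finite A" "B \<subseteq> tuples A k"
    and L: "\<And>a. a \<in> tuples A k \<Longrightarrow> L_diamond A a Q \<in> M"
  shows "K_lang A k Q B \<in> M"
proof -
  interpret algebra "lists A" M by fact
  have "(\<Union>a\<in>tuples A k. if a \<in> B then lists A - L_diamond A a Q else L_diamond A a Q) \<in> M"
    using L by (intro finite_UN finite_tuples assms) auto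
  then show ?thesis
    unfolding K_lang_eq_Diff_UN[OF assms(3)] by (rule compl_sets)
qed

lemma colouring_pair:
  assumes "Q \<subseteq> tuples UNIV k"
  shows "colouring k 2 [Q, tuples UNIV k - Q]"
  using assms by (auto simp: colouring_def less_2_cases_iff lessThan_nat_numeral lessThan_Suc)

lemma K_langs_subset:
  assumes "Qs \<noteq> []"
  shows "K_langs A k Qs Bs \<subseteq> lists A"
proof -
  have "K_langs A k Qs Bs \<subseteq> K_lang A k (Qs ! 0) (Bs ! 0)"
    unfolding K_langs_def using assms by (intro INT_lower) auto
  then show ?thesis
    by (auto simp: K_lang_def)
qed

lemma K_langs_pair: "K_langs A k [Q, Q'] [B, B'] = K_lang A k Q B \<inter> K_lang A k Q' B'"
  by (auto simp: K_langs_def lessThan_Suc)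

text \<open>A word w lies in the member indexed by its own contents on Q and Q'. Letting B' range
  over all of \<open>Pow (tuples A k)\<close> leaves the content on Q' unconstrained.\<close>

lemma L_diamond_eq_UN_K_langs:
  assumes "a \<in> tuples A k"
  shows "L_diamond A a Q =
    (\<Union>(B, B')\<in>{B \<in> Pow (tuples A k). a \<in> B} \<times> Pow (tuples A k). K_langs A k [Q, Q'] [B, B'])"
  using assms content_subset[of A k _ Q] content_subset[of A k _ Q']
  by (auto simp: K_langs_pair K_lang_def L_diamond_def) (auto simp: content_def)

theorem mainTheorem8:
  fixes A :: "'a set" and k :: nat
  assumes "finite A" and "k \<ge> 1"
  shows "Bool_alg A k = generated_algebra (lists A)
    {K_langs A k Qs Bs | l Qs Bs. l \<ge> 1 \<and> colouring k l Qs \<and> Bs \<in> tuples (Pow (tuples A k)) l}"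
  (is "_ = generated_algebra _ ?\<K>")
proof
  \<comment> \<open>This rules out the junk value \<open>UNIV\<close> of
    \<open>generated_algebra\<close>.\<close>
  have "?\<K> \<subseteq> Pow (lists A)"
  proof (intro subsetI, elim CollectE exE conjE)
    fix X l Qs Bs
    assume X: "X = K_langs A k Qs Bs" and "1 \<le> l" "colouring k l Qs"
    then have "Qs \<noteq> []"
      by (auto simp: colouring_def)
    then show "X \<in> Pow (lists A)"
      unfolding X by (intro PowI K_langs_subset)
  qed
  then have alg: "algebra (lists A) (generated_algebra (lists A) ?\<K>)"
    by (rule algebra_generated_algebra)
  then interpret K: algebra "lists A" "generated_algebra (lists A) ?\<K>" .
  have "L_diamond A a Q \<in> generated_algebra (lists A) ?\<K>"
    if a: "a \<in> tuples A k" and Q: "Q \<subseteq> tuples UNIV k" for a Q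
  proof -
    have "K_langs A k [Q, tuples UNIV k - Q] [B, B'] \<in> generated_algebra (lists A) ?\<K>"
      if "B \<subseteq> tuples A k" "B' \<subseteq> tuples A k" for B B'
    proof -
      have "[B, B'] \<in> tuples (Pow (tuples A k)) 2"
        using that by (simp add: tuples_def)
      \<comment> \<open>The number of colours is witnessed by l = 2.\<close>
      then have "K_langs A k [Q, tuples UNIV k - Q] [B, B'] \<in> ?\<K>"
        using colouring_pair[OF Q] one_le_numeral by blast
      then show ?thesis
        by (rule subsetD[OF generated_algebra_superset])
    qed
    then show ?thesis
      unfolding L_diamond_eq_UN_K_langs[OF a, of Q "tuples UNIV k - Q"]
      using finite_tuples[OF assms(1)] by (intro K.finite_UN) auto
  qed
  then show "Bool_alg A k \<subseteq> generated_algebra (lists A) ?\<K>"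
    unfolding Bool_alg_def by (intro generated_algebra_minimal alg) auto
next
  have alg: "algebra (lists A) (Bool_alg A k)"
    unfolding Bool_alg_def by (rule algebra_generated_algebra) (auto simp: L_diamond_def)
  then interpret L: algebra "lists A" "Bool_alg A k" .
  have L: "L_diamond A a Q \<in> Bool_alg A k" if "a \<in> tuples A k" "Q \<subseteq> tuples UNIV k" for a Q
    unfolding Bool_alg_def using that by (intro subsetD[OF generated_algebra_superset]) blast
  have "K_langs A k Qs Bs \<in> Bool_alg A k"
    if l: "l \<ge> 1" and Qs: "colouring k l Qs" and Bs: "Bs \<in> tuples (Pow (tuples A k)) l"
    for l Qs Bs
  proof -
    have "K_lang A k (Qs ! j) (Bs ! j) \<in> Bool_alg A k" if "j < l" for j
    proof (intro K_lang_in_algebra alg assms(1) L)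
      show "Bs ! j \<subseteq> tuples A k"
        \<comment> \<open>The instantiation unfolds the outer \<open>tuples\<close> and keeps
          \<open>tuples A k\<close> folded.\<close>
        using Bs that nth_mem[of j Bs] unfolding tuples_def[of "Pow _"] by blast
      show "Qs ! j \<subseteq> tuples UNIV k"
        using Qs that by (auto simp: colouring_def)
    qed
    moreover have "length Qs = l"
      using Qs by (simp add: colouring_def)
    \<comment> \<open>\<open>finite_INT\<close> needs a nonempty index set, which l \<ge> 1
      provides.\<close>
    ultimately show ?thesis
      unfolding K_langs_def using l by (intro L.finite_INT) (auto simp: lessThan_empty_iff)
  qed
  then show "generated_algebra (lists A) ?\<K> \<subseteq> Bool_alg A k"
    by (intro generated_algebra_minimal alg) auto
qed

end
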